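(* The variety $\mathsf{NA}$ of Nelson algebras is a subvariety of the variety $\mathsf{SNA}$ of subresiduated Nelson algebras; that is, every Nelson algebra is a subresiduated Nelson algebra.
   Context: A Kleene algebra is a bounded distributive lattice $\langle T,\wedge,\vee,0,1\rangle$ with a unary operation $\sim$ satisfying $\sim\sim x=x$, $\sim(x\wedge y)=\sim x\vee\sim y$, $(x\wedge\sim x)\wedge(y\vee\sim y)=x\wedge\sim x$. A Nelson algebra is an algebra $\langle T,\wedge,\vee,\to,\sim,0,1\rangle$ of type $(2,2,2,1,0,0)$ such that $\langle T,\wedge,\vee,\sim,0,1\rangle$ is a Kleene algebra and the following hold for all $x,y,z\in T$: (Ne4) $x\to x=1$; (Ne5) $x\to(y\to z)=(x\wedge y)\to z$; (Ne6) $x\wedge(x\to y)=x\wedge(\sim x\vee y)$; (Ne7) $\sim x\vee y\le x\to y$; (Ne8) $x\to(y\wedge z)=(x\to y)\wedge(x\to z)$. A subresiduated Nelson algebra is an algebra $\langle T,\wedge,\vee,\to,\sim,0,1\rangle$ of type $(2,2,2,1,0,0)$ such that $\langle T,\wedge,\vee,\sim,0,1\rangle$ is a Kleene algebra and for all $x,y,z\in T$: (1) $(x\vee y)\to z=(x\to z)\wedge(y\to z)$; (2) $z\to(x\wedge y)=(z\to x)\wedge(z\to y)$; (3) $((x\to y)\wedge(y\to z))\to(x\to z)=1$; (4) $x\to x=1$; (5) $x\wedge(x\to y)\le x\wedge(\sim x\vee y)$; (6) $x\to y\le z\to(x\to y)$; (7) $\sim(x\to y)\to(x\wedge\sim y)=1$;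 (8) $(x\wedge\sim y)\to\sim(x\to y)=1$. *)

theory Defs
  imports Main
begin

text \<open>
  The algebras carry only the operations of the type \<open>(2,2,2,1,0,0)\<close>; the lattice order is
  therefore not a parameter but is read off from the meet.
\<close>

abbreviation (input) meet_le :: "('a \<Rightarrow> 'a \<Rightarrow> 'a) \<Rightarrow> 'a \<Rightarrow> 'a \<Rightarrow> bool"
  where "meet_le meet x y \<equiv> meet x y = x"

abbreviation (input) meet_less :: "('a \<Rightarrow> 'a \<Rightarrow> 'a) \<Rightarrow> 'a \<Rightarrow> 'a \<Rightarrow> bool"
  where "meet_less meet x y \<equiv> meet_le meet x y \<and> x \<noteq> y"

text \<open>The library's bounded lattices do not require \<open>0 \<noteq> 1\<close>, so trivial algebras are included.\<close>

locale kleene_algebra =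
  distrib_lattice meet "meet_le meet" "meet_less meet" join +
  bounded_lattice meet "meet_le meet" "meet_less meet" join zero one
  for meet :: "'a \<Rightarrow> 'a \<Rightarrow> 'a" (infixl "\<sqinter>" 70)
    and join :: "'a \<Rightarrow> 'a \<Rightarrow> 'a" (infixl "\<squnion>" 65)
    and zero :: 'a ("\<zero>")
    and one :: 'a ("\<one>") +
  fixes neg :: "'a \<Rightarrow> 'a" ("\<sim> _" [81] 80)
  assumes neg_neg: "\<sim> (\<sim> x) = x"
    and neg_meet: "\<sim> (x \<sqinter> y) = \<sim> x \<squnion> \<sim> y"
    and kleene: "(x \<sqinter> \<sim> x) \<sqinter> (y \<squnion> \<sim> y) = x \<sqinter> \<sim> x"

locale nelson_algebra =
  kleene_algebra meet join zero one neg
  for meet :: "'a \<Rightarrow> 'a \<Rightarrow> 'a" (infixl "\<sqinter>" 70)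
    and join :: "'a \<Rightarrow> 'a \<Rightarrow> 'a" (infixl "\<squnion>" 65)
    and imp :: "'a \<Rightarrow> 'a \<Rightarrow> 'a" (infixr "\<rightarrow>" 60)
    and neg :: "'a \<Rightarrow> 'a" ("\<sim> _" [81] 80)
    and zero :: 'a ("\<zero>")
    and one :: 'a ("\<one>") +
  assumes Ne4: "x \<rightarrow> x = \<one>"
    and Ne5: "x \<rightarrow> (y \<rightarrow> z) = (x \<sqinter> y) \<rightarrow> z"
    and Ne6: "x \<sqinter> (x \<rightarrow> y) = x \<sqinter> (\<sim> x \<squnion> y)"
    and Ne7: "meet_le (\<sqinter>) (\<sim> x \<squnion> y) (x \<rightarrow> y)"
    and Ne8: "x \<rightarrow> (y \<sqinter> z) = (x \<rightarrow> y) \<sqinter> (x \<rightarrow> z)"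

locale subresiduated_nelson_algebra =
  kleene_algebra meet join zero one neg
  for meet :: "'a \<Rightarrow> 'a \<Rightarrow> 'a" (infixl "\<sqinter>" 70)
    and join :: "'a \<Rightarrow> 'a \<Rightarrow> 'a" (infixl "\<squnion>" 65)
    and imp :: "'a \<Rightarrow> 'a \<Rightarrow> 'a" (infixr "\<rightarrow>" 60)
    and neg :: "'a \<Rightarrow> 'a" ("\<sim> _" [81] 80)
    and zero :: 'a ("\<zero>")
    and one :: 'a ("\<one>") +
  assumes SN1: "(x \<squnion> y) \<rightarrow> z = (x \<rightarrow> z) \<sqinter> (y \<rightarrow> z)"
    and SN2: "z \<rightarrow> (x \<sqinter> y) = (z \<rightarrow> x) \<sqinter> (z \<rightarrow> y)"
    and SN3: "((x \<rightarrow> y) \<sqinter> (y \<rightarrow> z)) \<rightarrow> (x \<rightarrow> z) = \<one>"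
    and SN4: "x \<rightarrow> x = \<one>"
    and SN5: "meet_le (\<sqinter>) (x \<sqinter> (x \<rightarrow> y)) (x \<sqinter> (\<sim> x \<squnion> y))"
    and SN6: "meet_le (\<sqinter>) (x \<rightarrow> y) (z \<rightarrow> (x \<rightarrow> y))"
    and SN7: "\<sim> (x \<rightarrow> y) \<rightarrow> (x \<sqinter> \<sim> y) = \<one>"
    and SN8: "(x \<sqinter> \<sim> y) \<rightarrow> \<sim> (x \<rightarrow> y) = \<one>"

end

theory Submission
  imports Defs
begin

text \<open>
  Write \<open>\<sqsubseteq>\<close> for the lattice order and \<open>x \<preceq> y\<close> for \<open>x \<rightarrow> y = 1\<close>. In a Nelson algebra the
  implication is a Heyting implication for the quasi-order \<open>\<preceq>\<close> (lemma \<open>entails_imp_iff\<close>), but in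
  general not for the lattice order. Two facts connect the two orders.

  First, \<open>x \<preceq> y\<close> is a lattice inequality: it means \<open>x \<sqsubseteq> \<sim> x \<squnion> y\<close> (lemma \<open>entails_iff\<close>). The
  properties of \<open>\<preceq>\<close> thereby become computations in the Kleene algebra; contraposition gives
  transitivity and the Kleene inequality gives compatibility with joins. By the same criterion the
  equivalence of \<open>\<sim> (x \<rightarrow> y)\<close> and \<open>x \<sqinter> \<sim> y\<close> under \<open>\<preceq>\<close>, which is \<open>SN7\<close> and \<open>SN8\<close>, follows from
  the lower estimate of \<open>x \<rightarrow> y\<close> in \<open>Ne7\<close> and the upper estimate in \<open>Ne6\<close>.

  Second, \<open>x \<sqsubseteq> y\<close> holds as soon as \<open>x \<preceq> y\<close> and \<open>\<sim> y \<preceq> \<sim> x\<close> (lemma \<open>leq_if_entails\<close>).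
  This yields \<open>SN1\<close>: under \<open>\<preceq>\<close> the two sides are compared as in a Heyting algebra, and for
  their negations \<open>SN7\<close> and \<open>SN8\<close> reduce the comparison to distributivity. \<open>SN3\<close> speaks of
  \<open>\<preceq>\<close> only and is again the Heyting argument.
\<close>

section \<open>The order of a Kleene algebra\<close>

context kleene_algebra
begin

text \<open>
  A constant for the order, so that the laws of lattices are available as inequalities and not only
  as the equations that result from reading the order off from the meet.
\<close>

definition leq :: "'a \<Rightarrow> 'a \<Rightarrow> bool" (infix "\<sqsubseteq>" 50)
  where "x \<sqsubseteq> y \<longleftrightarrow> x \<sqinter> y = x"

definition less :: "'a \<Rightarrow> 'a \<Rightarrow> bool" (infix "\<sqsubset>" 50)
  where "x \<sqsubset> y \<longleftrightarrow> x \<sqsubseteq> y \<and> x \<noteq> y"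

sublocale ord: distrib_lattice "(\<sqinter>)" "(\<sqsubseteq>)" "(\<sqsubset>)" "(\<squnion>)"
proof -
  have "(\<sqsubseteq>) = (\<lambda>x y. x \<sqinter> y = x)" "(\<sqsubset>) = (\<lambda>x y. x \<sqinter> y = x \<and> x \<noteq> y)"
    by (simp_all add: fun_eq_iff leq_def less_def)
  then show "class.distrib_lattice (\<sqinter>) (\<sqsubseteq>) (\<sqsubset>) (\<squnion>)"
    using distrib_lattice_axioms by simp
qed

declare ord.order_trans [trans]

lemma leq_one: "x \<sqsubseteq> \<one>"
  by (simp add: leq_def)

lemma one_leq_iff: "\<one> \<sqsubseteq> x \<longleftrightarrow> x = \<one>"
  using leq_one ord.order_antisym by blast

lemma neg_join: "\<sim> (x \<squnion> y) = \<sim> x \<sqinter> \<sim> y"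
  by (metis neg_meet neg_neg)

lemma neg_leq_neg_iff: "\<sim> x \<sqsubseteq> \<sim> y \<longleftrightarrow> y \<sqsubseteq> x"
  by (metis neg_meet neg_neg ord.le_iff_inf ord.le_iff_sup ord.sup_commute ord.inf_commute)

lemma kleene_leq: "x \<sqinter> \<sim> x \<sqsubseteq> y \<squnion> \<sim> y"
  by (simp add: leq_def kleene)

lemma contrapose: "x \<sqsubseteq> \<sim> x \<squnion> y \<longleftrightarrow> x \<sqinter> \<sim> y \<sqsubseteq> \<sim> x"
  by (metis neg_leq_neg_iff neg_join neg_neg)

text \<open>Cut: the disjunction is resolved by distributing the meet over it.\<close>

lemma leq_cases: "x \<sqsubseteq> y \<squnion> z \<Longrightarrow> x \<sqinter> y \<sqsubseteq> w \<Longrightarrow> x \<sqinter> z \<sqsubseteq> w \<Longrightarrow> x \<sqsubseteq> w"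
  by (metis ord.inf_absorb1 ord.inf_sup_distrib1 ord.sup_least)

end

section \<open>Entailment\<close>

context nelson_algebra
begin

abbreviation entails :: "'a \<Rightarrow> 'a \<Rightarrow> bool" (infix "\<preceq>" 50)
  where "x \<preceq> y \<equiv> x \<rightarrow> y = \<one>"

lemma imp_mono: "y \<sqsubseteq> z \<Longrightarrow> x \<rightarrow> y \<sqsubseteq> x \<rightarrow> z"
  by (metis Ne8 leq_def)

lemma join_leq_imp: "\<sim> x \<squnion> y \<sqsubseteq> x \<rightarrow> y"
  using Ne7 by (simp add: leq_def)

text \<open>
  By \<open>Ne6\<close> the inequality says that \<open>x \<sqsubseteq> x \<rightarrow> y\<close>, and then \<open>x \<rightarrow> x \<sqsubseteq> x \<rightarrow> (x \<rightarrow> y) = x \<rightarrow> y\<close>.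
\<close>

lemma entails_iff: "x \<preceq> y \<longleftrightarrow> x \<sqsubseteq> \<sim> x \<squnion> y"
proof
  assume "x \<preceq> y"
  then show "x \<sqsubseteq> \<sim> x \<squnion> y"
    using Ne6 [of x y] by (simp add: leq_def)
next
  assume "x \<sqsubseteq> \<sim> x \<squnion> y"
  then have "x \<sqsubseteq> x \<rightarrow> y"
    using Ne6 [of x y] by (simp add: leq_def)
  then have "x \<rightarrow> x \<sqsubseteq> x \<rightarrow> (x \<rightarrow> y)"
    by (rule imp_mono)
  also have "x \<rightarrow> (x \<rightarrow> y) = x \<rightarrow> y"
    by (simp add: Ne5)
  finally show "x \<preceq> y"
    by (simp add: Ne4 one_leq_iff)
qed

lemma leq_imp_entails: "x \<sqsubseteq> y \<Longrightarrow> x \<preceq> y"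
  by (simp add: entails_iff ord.le_supI2)

lemma entails_imp_iff: "x \<preceq> y \<rightarrow> z \<longleftrightarrow> x \<sqinter> y \<preceq> z"
  by (simp add: Ne5)

lemma modus_ponens: "(x \<rightarrow> y) \<sqinter> x \<preceq> y"
  using entails_imp_iff Ne4 by blast

text \<open>
  On the part of \<open>x\<close> below \<open>y\<close>, the inequality for \<open>y \<preceq> z\<close> leaves \<open>x \<sqinter> \<sim> y\<close> as the only
  obstacle, and this lies below \<open>\<sim> x\<close> by contraposition of \<open>x \<preceq> y\<close>.
\<close>

lemma entails_trans [trans]:
  assumes "x \<preceq> y" and "y \<preceq> z"
  shows "x \<preceq> z"
proof -
  have xy: "x \<sqsubseteq> \<sim> x \<squnion> y" and yz: "y \<sqsubseteq> \<sim> y \<squnion> z"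
    using assms by (simp_all add: entails_iff)
  have "x \<sqinter> \<sim> y \<sqsubseteq> \<sim> x"
    using xy by (simp add: contrapose)
  then have "x \<sqinter> y \<sqinter> \<sim> y \<sqsubseteq> \<sim> x \<squnion> z"
    by (meson ord.inf_mono ord.inf_le1 ord.order_refl ord.order_trans ord.sup_ge1)
  moreover have "x \<sqinter> y \<sqinter> z \<sqsubseteq> \<sim> x \<squnion> z"
    by (simp add: ord.le_infI2 ord.le_supI2)
  moreover have "x \<sqinter> y \<sqsubseteq> \<sim> y \<squnion> z"
    using yz by (rule ord.le_infI2)
  ultimately have "x \<sqinter> y \<sqsubseteq> \<sim> x \<squnion> z"
    using leq_cases by blast
  moreover have "x \<sqinter> \<sim> x \<sqsubseteq> \<sim> x \<squnion> z"
    by (simp add: ord.le_infI2)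
  ultimately have "x \<sqsubseteq> \<sim> x \<squnion> z"
    using xy leq_cases by blast
  then show ?thesis
    by (simp add: entails_iff)
qed

text \<open>
  The negation of \<open>x \<squnion> y\<close> is the meet of the negations, so that \<open>x \<sqsubseteq> \<sim> y \<squnion> z\<close> is needed as well.
  Now \<open>x\<close> lies below \<open>(x \<sqinter> \<sim> x) \<squnion> z\<close>, the Kleene inequality bounds \<open>x \<sqinter> \<sim> x\<close> by
  \<open>y \<squnion> \<sim> y\<close>, and \<open>y\<close> lies below \<open>\<sim> y \<squnion> z\<close>.
\<close>

lemma join_entails:
  assumes "x \<preceq> z" and "y \<preceq> z"
  shows "x \<squnion> y \<preceq> z"
proof -
  have cross: "a \<sqsubseteq> \<sim> b \<squnion> z" if "a \<preceq> z" "b \<preceq> z" for a b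
  proof -
    have a: "a \<sqsubseteq> \<sim> a \<squnion> z" and b: "b \<sqsubseteq> \<sim> b \<squnion> z"
      using that by (simp_all add: entails_iff)
    have "a \<sqinter> \<sim> a \<sqsubseteq> b \<squnion> \<sim> b"
      by (rule kleene_leq)
    also have "b \<squnion> \<sim> b \<sqsubseteq> \<sim> b \<squnion> z"
      using b by simp
    finally have "a \<sqinter> \<sim> a \<sqsubseteq> \<sim> b \<squnion> z" .
    moreover have "a \<sqinter> z \<sqsubseteq> \<sim> b \<squnion> z"
      by (simp add: ord.le_infI2)
    ultimately show ?thesis
      using a leq_cases by blast
  qed
  have "x \<squnion> y \<sqsubseteq> (\<sim> x \<squnion> z) \<sqinter> (\<sim> y \<squnion> z)"
    using assms cross by simp
  also have "(\<sim> x \<squnion> z) \<sqinter> (\<sim> y \<squnion> z) = \<sim> (x \<squnion> y) \<squnion> z"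
    by (simp add: neg_join ord.sup_inf_distrib2)
  finally show ?thesis
    by (simp add: entails_iff)
qed

text \<open>
  The first hypothesis splits \<open>x\<close> into \<open>x \<sqinter> \<sim> x\<close> and \<open>x \<sqinter> y\<close>. The Kleene inequality splits
  \<open>x \<sqinter> \<sim> x\<close> along \<open>y \<squnion> \<sim> y\<close>, and the second hypothesis is contraposed to \<open>\<sim> y \<sqinter> x \<sqsubseteq> y\<close>.
\<close>

lemma leq_if_entails:
  assumes "x \<preceq> y" and "\<sim> y \<preceq> \<sim> x"
  shows "x \<sqsubseteq> y"
proof -
  have "\<sim> y \<sqinter> x \<sqsubseteq> y"
    using assms(2) contrapose [of "\<sim> y" "\<sim> x"] by (simp add: entails_iff neg_neg)
  then have "x \<sqinter> \<sim> x \<sqinter> \<sim> y \<sqsubseteq> y"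
    by (meson ord.inf_le1 ord.inf_le2 ord.le_inf_iff ord.order_trans)
  then have "x \<sqinter> \<sim> x \<sqsubseteq> y"
    using leq_cases [OF kleene_leq [of x y]] by simp
  moreover have "x \<sqsubseteq> \<sim> x \<squnion> y"
    using assms(1) by (simp add: entails_iff)
  ultimately show ?thesis
    using leq_cases by simp
qed

section \<open>The axioms of subresiduated Nelson algebras\<close>

lemma neg_imp_leq: "\<sim> (x \<rightarrow> y) \<sqsubseteq> x \<sqinter> \<sim> y"
  by (metis join_leq_imp neg_join neg_leq_neg_iff neg_neg)

text \<open>After contraposition this is the upper estimate of \<open>x \<sqinter> (x \<rightarrow> y)\<close> contained in \<open>Ne6\<close>.\<close>

lemma entails_neg_imp: "x \<sqinter> \<sim> y \<preceq> \<sim> (x \<rightarrow> y)"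
proof -
  have "x \<sqinter> \<sim> y \<sqinter> (x \<rightarrow> y) \<sqsubseteq> x \<sqinter> (x \<rightarrow> y)"
    by (simp add: ord.le_infI1)
  also have "x \<sqinter> (x \<rightarrow> y) \<sqsubseteq> \<sim> x \<squnion> y"
    by (simp add: Ne6)
  finally have "x \<sqinter> \<sim> y \<sqinter> \<sim> (\<sim> (x \<rightarrow> y)) \<sqsubseteq> \<sim> (x \<sqinter> \<sim> y)"
    by (simp add: neg_meet neg_neg)
  then show ?thesis
    by (simp only: entails_iff contrapose)
qed

lemma imp_trans: "(x \<rightarrow> y) \<sqinter> (y \<rightarrow> z) \<preceq> x \<rightarrow> z"
proof -
  let ?c = "(x \<rightarrow> y) \<sqinter> (y \<rightarrow> z)"
  have "?c \<sqinter> x \<preceq> (x \<rightarrow> y) \<sqinter> x"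
    by (rule leq_imp_entails) (simp add: ord.le_infI1)
  also note modus_ponens
  finally have "?c \<sqinter> x \<preceq> y" .
  moreover have "?c \<sqinter> x \<preceq> y \<rightarrow> z"
    by (rule leq_imp_entails) (simp add: ord.le_infI1)
  ultimately have "?c \<sqinter> x \<preceq> (y \<rightarrow> z) \<sqinter> y"
    by (simp add: Ne8)
  also note modus_ponens
  finally show ?thesis
    by (simp add: entails_imp_iff)
qed

lemma join_imp: "(x \<squnion> y) \<rightarrow> z = (x \<rightarrow> z) \<sqinter> (y \<rightarrow> z)"
proof (rule ord.order_antisym)
  have antitone: "b \<rightarrow> z \<sqsubseteq> a \<rightarrow> z" if "a \<sqsubseteq> b" for a b
  proof -
    have "z \<sqsubseteq> a \<rightarrow> z"
      using join_leq_imp ord.le_sup_iff by blast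
    then have "b \<rightarrow> z \<sqsubseteq> b \<rightarrow> (a \<rightarrow> z)"
      by (rule imp_mono)
    also have "b \<rightarrow> (a \<rightarrow> z) = a \<rightarrow> z"
      using that by (simp add: Ne5 ord.inf_absorb2)
    finally show ?thesis .
  qed
  show "(x \<squnion> y) \<rightarrow> z \<sqsubseteq> (x \<rightarrow> z) \<sqinter> (y \<rightarrow> z)"
    by (simp add: antitone)
next
  let ?c = "(x \<rightarrow> z) \<sqinter> (y \<rightarrow> z)"
  show "?c \<sqsubseteq> (x \<squnion> y) \<rightarrow> z"
  proof (rule leq_if_entails)
    have "?c \<preceq> x \<rightarrow> z" and "?c \<preceq> y \<rightarrow> z"
      by (simp_all add: leq_imp_entails)
    then have "(?c \<sqinter> x) \<squnion> (?c \<sqinter> y) \<preceq> z"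
      by (simp only: entails_imp_iff join_entails)
    then show "?c \<preceq> (x \<squnion> y) \<rightarrow> z"
      by (simp only: entails_imp_iff ord.inf_sup_distrib1)
  next
    have "\<sim> ((x \<squnion> y) \<rightarrow> z) \<preceq> (x \<squnion> y) \<sqinter> \<sim> z"
      by (rule leq_imp_entails) (rule neg_imp_leq)
    also have "(x \<squnion> y) \<sqinter> \<sim> z = (x \<sqinter> \<sim> z) \<squnion> (y \<sqinter> \<sim> z)"
      by (rule ord.inf_sup_distrib2)
    also have "\<dots> \<preceq> \<sim> ?c"
    proof (rule join_entails)
      show "x \<sqinter> \<sim> z \<preceq> \<sim> ?c"
        by (rule entails_trans [OF entails_neg_imp leq_imp_entails]) (simp add: neg_meet)
      show "y \<sqinter> \<sim> z \<preceq> \<sim> ?c"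
        by (rule entails_trans [OF entails_neg_imp leq_imp_entails]) (simp add: neg_meet)
    qed
    finally show "\<sim> ((x \<squnion> y) \<rightarrow> z) \<preceq> \<sim> ?c" .
  qed
qed

end

theorem proposition3p1:
  fixes meet join imp :: "'a \<Rightarrow> 'a \<Rightarrow> 'a"
    and neg :: "'a \<Rightarrow> 'a"
    and zero one :: 'a
  assumes "nelson_algebra meet join imp neg zero one"
  shows "subresiduated_nelson_algebra meet join imp neg zero one"
proof -
  interpret nelson_algebra meet join imp neg zero one
    by (fact assms)
  show ?thesis
  proof (unfold_locales, fold leq_def)
    fix x y z
    show "imp (join x y) z = meet (imp x z) (imp y z)"
      by (rule join_imp)
    show "imp z (meet x y) = meet (imp z x) (imp z y)"
      by (rule Ne8)
    show "imp (meet (imp x y) (imp y z)) (imp x z) = one"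
      by (rule imp_trans)
    show "imp x x = one"
      by (rule Ne4)
    show "leq (meet x (imp x y)) (meet x (join (neg x) y))"
      by (simp add: Ne6)
    show "leq (imp x y) (imp z (imp x y))"
      using join_leq_imp ord.le_sup_iff by blast
    show "imp (neg (imp x y)) (meet x (neg y)) = one"
      by (rule leq_imp_entails) (rule neg_imp_leq)
    show "imp (meet x (neg y)) (neg (imp x y)) = one"
      by (rule entails_neg_imp)
  qed
qed

end
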